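(* Consider the discrete-time linear system $x_{k+1} = Ax_k + Bu_k + w_k$, $k\in\mathbb{N}$, with $x_k\in\mathbb{R}^n$, $u_k\in\mathbb{R}^m$, $x_0 = 0$, $(A,B)$ controllable, and i.i.d. process noise $w_k\sim N(0,W)$ with $W\succ 0$. Let $Q\succ 0$, $R\succ 0$. Let $K_0, K_1\in\mathbb{R}^{m\times n}$ be arbitrary gains with $\rho(A+BK_0)<1$ (no assumption on $K_1$), and let $M>0$, $t\in\mathbb{N}^*$. Let the input be generated by the following switched controller: a counter $\xi_k$ starts at $\xi_0=0$; at step $k$, if $\xi_k>0$ then $u_k = K_0x_k$ and $\xi_{k+1}=\xi_k-1$; if $\xi_k=0$ and $\|x_k\|\ge M$ then $u_k=K_0x_k$ and $\xi_{k+1}=t-1$; if $\xi_k=0$ and $\|x_k\|<M$ then $u_k=K_1x_k$ and $\xi_{k+1}=0$. Let $P_0\succ 0$ and $0<\rho_0<1$ satisfy $(A+BK_0)^TP_0(A+BK_0)\prec \rho_0 P_0$. Then the cost $$J=\limsup_{T\to\infty}\frac1T\mathbb{E}\Big[\sum_{k=0}^{T-1} x_k^TQx_k + u_k^TRu_k\Big]$$ satisfies $$J < \frac{\big(M^2\mathcal{A}^2\|P_0\| + \operatorname{tr}(WP_0)\big)\,\|Q_{01}\|_{P_0}}{1-\rho_0},$$ where $\mathcal{A} = \max\{\|A+BK_0\|,\|A+BK_1\|\}$ and $Q_{01} = Q + K_0^TRK_0 + K_1^TRK_1$.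
   Context: $\rho(\cdot)$ is the spectral radius, $\|\cdot\|$ is the Euclidean norm for vectors and the induced 2-norm for matrices. For positive definite matrices $P, Q'$, $\|Q'\|_P = \|P^{-1/2}Q'P^{-1/2}\| = \sup_{\|P^{1/2}v\|=1} v^TQ'v$. *)

theory Defs
  imports "HOL-Analysis.Analysis" "HOL-Probability.Probability"
begin

text \<open>Matrix power.\<close>
definition mat_pow :: "real^'n^'n \<Rightarrow> nat \<Rightarrow> real^'n^'n" where
  "mat_pow A i = (((**) A) ^^ i) (mat 1)"

text \<open>Spectral radius: largest modulus of a (complex) eigenvalue.\<close>
definition spectral_radius :: "real^'n^'n \<Rightarrow> real" where
  "spectral_radius A = Sup {cmod z | z. \<exists>v::complex^'n. v \<noteq> 0 \<and>
       map_matrix complex_of_real A *v v = z *s v}"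

text \<open>Controllability: rank [B, AB, ..., A^(n-1) B] = n.\<close>
definition controllable :: "real^'n^'n \<Rightarrow> real^'m^'n \<Rightarrow> bool" where
  "controllable A B \<longleftrightarrow> span (\<Union>i<CARD('n). columns (mat_pow A i ** B)) = UNIV"

definition posdef :: "real^'n^'n \<Rightarrow> bool" where
  "posdef P \<longleftrightarrow> transpose P = P \<and> (\<forall>v. v \<noteq> 0 \<longrightarrow> v \<bullet> (P *v v) > 0)"

text \<open>Induced 2-norm of a matrix.\<close>
definition mnorm :: "real^'n^'m \<Rightarrow> real" where
  "mnorm A = onorm ((*v) A)"

text \<open>Weighted norm  ||Q'||_P = sup over P^(1/2) v of norm 1 of v^T Q' v.\<close>
definition wnorm :: "real^'n^'n \<Rightarrow> real^'n^'n \<Rightarrow> real" where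
  "wnorm P Q' = Sup {v \<bullet> (Q' *v v) | v. v \<bullet> (P *v v) = 1}"

text \<open>Density of the multivariate normal distribution N(0,W).\<close>
definition gauss_density :: "real^'n^'n \<Rightarrow> real^'n \<Rightarrow> real" where
  "gauss_density W x = exp (- (x \<bullet> (matrix_inv W *v x)) / 2) / sqrt ((2 * pi) ^ CARD('n) * det W)"

text \<open>Switched controller: state x and counter xi give input and next counter.\<close>
definition ctrl :: "real^'n^'m \<Rightarrow> real^'n^'m \<Rightarrow> real \<Rightarrow> nat \<Rightarrow> real^'n \<Rightarrow> nat \<Rightarrow> (real^'m) \<times> (nat)" where
  "ctrl K0 K1 Mb t x xi =
     (if xi > 0 then (K0 *v x, xi - 1)
      else if norm x \<ge> Mb then (K0 *v x, t - 1)
      else (K1 *v x, 0))"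

text \<open>Closed loop trajectory (x_k, xi_k) for a noise path w.\<close>
primrec closed_loop :: "real^'n^'n \<Rightarrow> real^'m^'n \<Rightarrow> real^'n^'m \<Rightarrow> real^'n^'m \<Rightarrow> real \<Rightarrow> nat
    \<Rightarrow> (nat \<Rightarrow> real^'n) \<Rightarrow> nat \<Rightarrow> (real^'n) \<times> nat" where
  "closed_loop A B K0 K1 Mb t w 0 = (0, 0)"
| "closed_loop A B K0 K1 Mb t w (Suc k) =
     (let (x, xi) = closed_loop A B K0 K1 Mb t w k;
          (u, xi') = ctrl K0 K1 Mb t x xi
      in (A *v x + B *v u + w k, xi'))"

definition state :: "real^'n^'n \<Rightarrow> real^'m^'n \<Rightarrow> real^'n^'m \<Rightarrow> real^'n^'m \<Rightarrow> real \<Rightarrow> nat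
    \<Rightarrow> (nat \<Rightarrow> real^'n) \<Rightarrow> nat \<Rightarrow> real^'n" where
  "state A B K0 K1 Mb t w k = fst (closed_loop A B K0 K1 Mb t w k)"

definition input :: "real^'n^'n \<Rightarrow> real^'m^'n \<Rightarrow> real^'n^'m \<Rightarrow> real^'n^'m \<Rightarrow> real \<Rightarrow> nat
    \<Rightarrow> (nat \<Rightarrow> real^'n) \<Rightarrow> nat \<Rightarrow> real^'m" where
  "input A B K0 K1 Mb t w k =
     (let (x, xi) = closed_loop A B K0 K1 Mb t w k in fst (ctrl K0 K1 Mb t x xi))"

text \<open>Long-run average cost J (limsup of expected average stage cost), over sample space M
  with noise process w k :: 'a \<Rightarrow> real^'n.\<close>
definition avg_cost :: "'a measure \<Rightarrow> (nat \<Rightarrow> 'a \<Rightarrow> real^'n) \<Rightarrow> real^'n^'n \<Rightarrow> real^'m^'n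
    \<Rightarrow> real^'n^'m \<Rightarrow> real^'n^'m \<Rightarrow> real \<Rightarrow> nat \<Rightarrow> real^'n^'n \<Rightarrow> real^'m^'m \<Rightarrow> ereal" where
  "avg_cost P w A B K0 K1 Mb t Q R =
     limsup (\<lambda>T. ereal (1 / real T * integral\<^sup>L P (\<lambda>\<omega>.
        \<Sum>k<T. (let x = state A B K0 K1 Mb t (\<lambda>j. w j \<omega>) k;
                    u = input A B K0 K1 Mb t (\<lambda>j. w j \<omega>) k
                in x \<bullet> (Q *v x) + u \<bullet> (R *v u)))))"

end

theory Submission
  imports Defs "HOL-Real_Asymp.Real_Asymp"
begin

text \<open>The function $V(x) = x^T P_0 x$ is a Lyapunov function for the switched loop. Under $K_0$ it
  contracts by a factor $\rho_0 - \varepsilon$ for some $\varepsilon > 0$, because the contraction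
  hypothesis is a strict matrix inequality; under $K_1$ the state lies in the ball of radius $M$.
  Since the noise is centred and independent of the past, it adds exactly
  $\operatorname{tr}(W P_0)$ in expectation. Hence $E V(x_k)$ is bounded by
  $(M^2 \mathcal{A}^2 \|P_0\| + \operatorname{tr}(W P_0)) / (1 - \rho_0 + \varepsilon)$ for all
  $k$, and the margin $\varepsilon$ makes the final inequality strict.\<close>

section \<open>Quadratic forms\<close>

lemma quad_form_congruence:
  fixes M :: "real^'n^'m" and P :: "real^'m^'m"
  shows "x \<bullet> ((transpose M ** P ** M) *v x) = (M *v x) \<bullet> (P *v (M *v x))"
  by (simp add: matrix_vector_mul_assoc[symmetric] inner_commute[of x] dot_lmul_matrix)
    (simp add: inner_commute)

lemma posdef_selfadjoint:
  assumes "posdef P"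
  shows "(P *v x) \<bullet> y = x \<bullet> (P *v y)"
  using assms unfolding posdef_def
  by (metis dot_lmul_matrix transpose_matrix_vector)

lemma posdef_nonneg: "posdef P \<Longrightarrow> 0 \<le> v \<bullet> (P *v v)"
  unfolding posdef_def by (cases "v = 0") (auto intro: less_imp_le)

lemma norm_mult_le_mnorm: "norm (M *v x) \<le> mnorm M * norm x"
  unfolding mnorm_def by (rule onorm) simp

lemma mnorm_nonneg: "0 \<le> mnorm M"
  unfolding mnorm_def by (rule onorm_pos_le) simp

lemma quad_form_le_mnorm: "v \<bullet> (M *v v) \<le> mnorm M * (norm v)\<^sup>2"
proof -
  have "v \<bullet> (M *v v) \<le> norm v * norm (M *v v)" by (rule norm_cauchy_schwarz)
  also have "\<dots> \<le> norm v * (mnorm M * norm v)"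
    by (intro mult_left_mono norm_mult_le_mnorm) simp
  finally show ?thesis by (simp add: power2_eq_square algebra_simps)
qed

text \<open>Compactness of the unit sphere gives the form a minimum there, positive by definiteness;
  homogeneity of degree two carries this bound to all vectors.\<close>

lemma posdef_coercive:
  fixes P :: "real^'n^'n"
  assumes "posdef P"
  obtains l where "l > 0" "\<And>v. l * (norm v)\<^sup>2 \<le> v \<bullet> (P *v v)"
proof -
  let ?S = "sphere 0 1 :: (real^'n) set"
  have ne: "?S \<noteq> {}" by simp
  have "continuous_on ?S (\<lambda>v. v \<bullet> (P *v v))" by (intro continuous_intros)
  from continuous_attains_inf[OF _ ne this] obtain m
    where m: "m \<in> ?S" "\<And>v. v \<in> ?S \<Longrightarrow> m \<bullet> (P *v m) \<le> v \<bullet> (P *v v)" by auto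
  show ?thesis
  proof (rule that[of "m \<bullet> (P *v m)"])
    have "m \<noteq> 0" using m(1) by auto
    then show "m \<bullet> (P *v m) > 0" using assms by (auto simp: posdef_def)
    fix v :: "real^'n"
    show "m \<bullet> (P *v m) * (norm v)\<^sup>2 \<le> v \<bullet> (P *v v)"
    proof (cases "v = 0")
      case False
      define u where "u = (1 / norm v) *\<^sub>R v"
      have "u \<in> ?S" using False by (auto simp: u_def)
      from m(2)[OF this] have "m \<bullet> (P *v m) \<le> u \<bullet> (P *v u)" .
      then have "m \<bullet> (P *v m) * (norm v)\<^sup>2 \<le> u \<bullet> (P *v u) * (norm v)\<^sup>2"
        by (rule mult_right_mono) simp
      also have "u \<bullet> (P *v u) * (norm v)\<^sup>2 = v \<bullet> (P *v v)"
        using False by (simp add: u_def matrix_vector_mult_scaleR power2_eq_square)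
      finally show ?thesis .
    qed simp
  qed
qed

lemma quad_form_add: "x \<bullet> ((M + N) *v x) = x \<bullet> (M *v x) + x \<bullet> (N *v x)"
  by (simp add: matrix_vector_mult_add_rdistrib inner_right_distrib)

text \<open>As \<open>wnorm\<close> is a supremum in the reals, it bounds its set only once that set
  is bounded above. Coercivity of \<open>P\<close> makes the constraint
  \<open>v \<bullet> (P *v v) = 1\<close> describe a bounded set; every nonzero vector can then be
  scaled onto it.\<close>

lemma
  fixes P M :: "real^'n^'n"
  assumes "posdef P"
  shows quad_form_le_wnorm: "v \<bullet> (M *v v) \<le> wnorm P M * (v \<bullet> (P *v v))"
    and wnorm_pos: "posdef M \<Longrightarrow> 0 < wnorm P M"
proof -
  obtain l where l: "l > 0" "\<And>v. l * (norm v)\<^sup>2 \<le> v \<bullet> (P *v v)"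
    using posdef_coercive[OF assms] by blast
  have bdd: "bdd_above {v \<bullet> (M *v v) | v. v \<bullet> (P *v v) = 1}"
  proof (rule bdd_aboveI[of _ "mnorm M / l"], clarsimp)
    fix v assume "v \<bullet> (P *v v) = 1"
    with l(2)[of v] l(1) have "(norm v)\<^sup>2 \<le> 1 / l" by (simp add: field_simps)
    then have "mnorm M * (norm v)\<^sup>2 \<le> mnorm M * (1 / l)"
      by (rule mult_left_mono) (rule mnorm_nonneg)
    with quad_form_le_mnorm[of v M] show "v \<bullet> (M *v v) \<le> mnorm M / l" by simp
  qed
  have normalise: "v \<bullet> (M *v v) / (v \<bullet> (P *v v)) \<le> wnorm P M" if "v \<noteq> 0" for v
  proof -
    define q where "q = v \<bullet> (P *v v)"
    have q: "q > 0" using assms that by (auto simp: q_def posdef_def)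
    define u where "u = (1 / sqrt q) *\<^sub>R v"
    have "u \<bullet> (P *v u) = 1" "u \<bullet> (M *v u) = v \<bullet> (M *v v) / q"
      using q by (simp_all add: u_def matrix_vector_mult_scaleR q_def[symmetric] field_simps)
    then show ?thesis unfolding wnorm_def q_def[symmetric]
      by (intro cSup_upper bdd) force
  qed
  show "v \<bullet> (M *v v) \<le> wnorm P M * (v \<bullet> (P *v v))"
  proof (cases "v = 0")
    case False
    then have "v \<bullet> (P *v v) > 0" using assms by (auto simp: posdef_def)
    with normalise[OF False] show ?thesis by (simp add: field_simps)
  qed simp
  show "0 < wnorm P M" if "posdef M"
  proof -
    obtain v :: "real^'n" where v: "v \<noteq> 0" using zero_neq_one by blast
    then have "v \<bullet> (M *v v) / (v \<bullet> (P *v v)) > 0"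
      using assms that by (auto simp: posdef_def)
    with normalise[OF v] show ?thesis by linarith
  qed
qed

text \<open>Turns the strict matrix inequality into the uniform margin that later makes the cost
  bound strict: coercivity of \<open>r *\<^sub>R P - N\<close> leaves room for a small multiple of
  \<open>P\<close>.\<close>

lemma posdef_diff_margin:
  fixes P N :: "real^'n^'n"
  assumes "posdef P" "posdef (r *\<^sub>R P - N)" "0 < r"
  obtains e where "0 < e" "e \<le> r" "\<And>v. v \<bullet> (N *v v) \<le> (r - e) * (v \<bullet> (P *v v))"
proof -
  obtain l where l: "l > 0" "\<And>v. l * (norm v)\<^sup>2 \<le> v \<bullet> ((r *\<^sub>R P - N) *v v)"
    using posdef_coercive[OF assms(2)] by blast
  \<comment> \<open>The \<open>+ 1\<close> keeps the denominator positive, and the minimum with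
    \<open>r\<close> keeps the contraction factor \<open>r - e\<close> nonnegative.\<close>
  define e where "e = min r (l / (mnorm P + 1))"
  have p: "mnorm P + 1 > 0" using mnorm_nonneg[of P] by simp
  show ?thesis
  proof (rule that[of e])
    show "0 < e" "e \<le> r" using l(1) p assms(3) by (auto simp: e_def)
    fix v
    have "e * (v \<bullet> (P *v v)) \<le> l / (mnorm P + 1) * (v \<bullet> (P *v v))"
      by (intro mult_right_mono posdef_nonneg assms) (simp add: e_def)
    also have "\<dots> \<le> l / (mnorm P + 1) * ((mnorm P + 1) * (norm v)\<^sup>2)"
      using quad_form_le_mnorm[of v P] l(1) p
      by (intro mult_left_mono) (auto simp: algebra_simps add_increasing)
    also have "\<dots> = l * (norm v)\<^sup>2" using p by simp
    also have "\<dots> \<le> r * (v \<bullet> (P *v v)) - v \<bullet> (N *v v)"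
      using l(2)[of v]
      by (simp add: matrix_vector_mult_diff_rdistrib inner_diff_right scaleR_matrix_vector_assoc[symmetric])
    finally show "v \<bullet> (N *v v) \<le> (r - e) * (v \<bullet> (P *v v))" by (simp add: algebra_simps)
  qed
qed

lemma posdef_matrix_inv:
  assumes "posdef W"
  shows "W ** matrix_inv W = mat 1" "matrix_inv W ** W = mat 1"
proof -
  have "\<forall>x. W *v x = 0 \<longrightarrow> x = 0"
    using assms unfolding posdef_def by (metis inner_zero_right less_irrefl)
  then have "invertible W"
    by (simp add: invertible_left_inverse matrix_left_invertible_ker)
  then have "W ** matrix_inv W = mat 1 \<and> matrix_inv W ** W = mat 1"
    unfolding invertible_def matrix_inv_def by (rule someI_ex)
  then show "W ** matrix_inv W = mat 1" "matrix_inv W ** W = mat 1" by auto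
qed

section \<open>Moments of the centred Gaussian\<close>

lemma gauss_density_uminus: "gauss_density W (- x) = gauss_density W x"
  by (simp add: gauss_density_def vec.neg)

text \<open>Translating the density by $W u$ multiplies it by an exponential of a linear form, so
  translation invariance of Lebesgue measure gives the moment generating function without
  diagonalising $W$ or evaluating the normalising constant.\<close>

lemma gauss_density_translate:
  assumes "posdef W"
  shows "gauss_density W (W *v u + x)
    = gauss_density W x * exp (- (u \<bullet> x)) * exp (- (u \<bullet> (W *v u)) / 2)"
proof -
  let ?V = "matrix_inv W"
  have 1: "?V *v (W *v u) = u" "W *v (?V *v x) = x"
    by (simp_all add: matrix_vector_mul_assoc posdef_matrix_inv[OF assms])
  have 2: "(W *v u) \<bullet> (?V *v x) = u \<bullet> x"
    by (simp add: posdef_selfadjoint[OF assms] 1)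
  have "(W *v u + x) \<bullet> (?V *v (W *v u + x)) = u \<bullet> (W *v u) + 2 * (u \<bullet> x) + x \<bullet> (?V *v x)"
    by (simp add: matrix_vector_right_distrib 1 2 inner_add_left inner_add_right inner_commute)
  then show ?thesis
    by (simp add: gauss_density_def mult_exp_exp add_divide_distrib diff_divide_distrib
        algebra_simps)
qed

lemma matrix_vector_mult_measurable [measurable]:
  "(\<lambda>x. (M :: real^'n^'m) *v x) \<in> borel_measurable borel"
  by (intro borel_measurable_continuous_onI continuous_intros)

lemma vec_nth_measurable [measurable (raw)]:
  fixes f :: "'a \<Rightarrow> real^'n"
  assumes "f \<in> borel_measurable M"
  shows "(\<lambda>x. f x $ i) \<in> borel_measurable M"
  using assms by (rule measurable_compose) (intro borel_measurable_continuous_onI continuous_intros)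

lemma gauss_density_measurable [measurable]: "gauss_density W \<in> borel_measurable borel"
  unfolding gauss_density_def by measurable

section \<open>Symmetry and exponential moments of one Gaussian vector\<close>

locale gaussian_vector = prob_space P for P :: "'a measure" +
  fixes W :: "real^'n^'n" and X :: "'a \<Rightarrow> real^'n"
  assumes dist: "distributed P lborel X (\<lambda>x. ennreal (gauss_density W x))"
    and posdef_cov: "posdef W"
begin

lemma rv [measurable]: "X \<in> borel_measurable P"
  using distributed_measurable[OF dist] by simp

lemma nn_integral_density:
  assumes "g \<in> borel_measurable borel"
  shows "(\<integral>\<^sup>+\<omega>. g (X \<omega>) \<partial>P) = (\<integral>\<^sup>+x. ennreal (gauss_density W x) * g x \<partial>lborel)"
  using distributed_nn_integral[OF dist, of g] assms by simp

text \<open>The density is even and Lebesgue measure is invariant under reflection, so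
  \<open>X\<close> and \<open>- X\<close> have the same law.\<close>

lemma nn_integral_uminus:
  assumes [measurable]: "g \<in> borel_measurable borel"
  shows "(\<integral>\<^sup>+\<omega>. g (- X \<omega>) \<partial>P) = (\<integral>\<^sup>+\<omega>. g (X \<omega>) \<partial>P)"
proof -
  have lb: "(lborel :: (real^'n) measure) = distr lborel borel uminus"
    by (subst lborel_affine[of "-1" 0]) (simp_all add: density_1)
  have "(\<integral>\<^sup>+\<omega>. g (X \<omega>) \<partial>P) = (\<integral>\<^sup>+x. ennreal (gauss_density W x) * g x \<partial>lborel)"
    by (rule nn_integral_density) fact
  also have "\<dots> = (\<integral>\<^sup>+x. ennreal (gauss_density W x) * g (- x) \<partial>lborel)"
    by (subst lb, subst nn_integral_distr) (simp_all add: gauss_density_uminus)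
  also have "\<dots> = (\<integral>\<^sup>+\<omega>. g (- X \<omega>) \<partial>P)"
    by (rule nn_integral_density[symmetric]) measurable
  finally show ?thesis ..
qed

text \<open>By symmetry the positive and negative parts have equal integrals. In the non-integrable
  case the Bochner integral is zero by convention, so the equation holds unconditionally.\<close>

lemma mean_zero: "(\<integral>\<omega>. u \<bullet> X \<omega> \<partial>P) = 0"
proof (cases "integrable P (\<lambda>\<omega>. u \<bullet> X \<omega>)")
  case True
  then show ?thesis
    using nn_integral_uminus[of "\<lambda>x. ennreal (u \<bullet> x)"]
    by (simp add: real_lebesgue_integral_def)
qed (rule not_integrable_integral_eq)

text \<open>The density has total mass one, also after translation by \<open>W *v (- u)\<close>. The
  translated density is the original one times \<open>exp (u \<bullet> x)\<close> and a constant,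
  and that constant must be the reciprocal of the moment generating function.\<close>

lemma nn_integral_exp: "(\<integral>\<^sup>+\<omega>. ennreal (exp (u \<bullet> X \<omega>)) \<partial>P) = ennreal (exp (u \<bullet> (W *v u) / 2))"
proof -
  let ?f = "\<lambda>x. ennreal (gauss_density W x)"
  have "1 = (\<integral>\<^sup>+\<omega>. 1 \<partial>P)" by (simp add: emeasure_space_1)
  also have "\<dots> = (\<integral>\<^sup>+x. ?f x \<partial>lborel)" using nn_integral_density[of "\<lambda>_. 1"] by simp
  also have "\<dots> = (\<integral>\<^sup>+x. ?f (W *v (- u) + x) \<partial>lborel)"
    by (subst lborel_distr_plus[symmetric, of "W *v (-u)"], subst nn_integral_distr) simp_all
  also have "\<dots> = (\<integral>\<^sup>+x. ?f x * ennreal (exp (u \<bullet> x)) * ennreal (exp (- (u \<bullet> (W *v u)) / 2)) \<partial>lborel)"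
    unfolding gauss_density_translate[OF posdef_cov] by (simp add: ennreal_mult'' vec.neg)
  also have "\<dots> = (\<integral>\<^sup>+x. ?f x * ennreal (exp (u \<bullet> x)) \<partial>lborel) * ennreal (exp (- (u \<bullet> (W *v u)) / 2))"
    by (rule nn_integral_multc) measurable
  also have "(\<integral>\<^sup>+x. ?f x * ennreal (exp (u \<bullet> x)) \<partial>lborel) = (\<integral>\<^sup>+\<omega>. ennreal (exp (u \<bullet> X \<omega>)) \<partial>P)"
    by (rule nn_integral_density[symmetric]) measurable
  finally have *: "1 = (\<integral>\<^sup>+\<omega>. ennreal (exp (u \<bullet> X \<omega>)) \<partial>P) * ennreal (exp (- (u \<bullet> (W *v u)) / 2))" .
  from arg_cong[OF *, of "\<lambda>r. r * ennreal (exp (u \<bullet> (W *v u) / 2))"]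
  have "1 * ennreal (exp (u \<bullet> (W *v u) / 2)) = (\<integral>\<^sup>+\<omega>. ennreal (exp (u \<bullet> X \<omega>)) \<partial>P)
     * (ennreal (exp (- (u \<bullet> (W *v u)) / 2)) * ennreal (exp (u \<bullet> (W *v u) / 2)))"
    by (simp only: mult.assoc)
  then show ?thesis by (simp add: ennreal_mult''[symmetric] mult_exp_exp)
qed

lemma has_bochner_integral_exp:
  "has_bochner_integral P (\<lambda>\<omega>. exp (u \<bullet> X \<omega>)) (exp (u \<bullet> (W *v u) / 2))"
  by (rule has_bochner_integral_nn_integral) (simp_all add: nn_integral_exp)

lemmas integrable_exp = has_bochner_integral_exp[THEN integrable.intros]
lemmas integral_exp = has_bochner_integral_exp[THEN has_bochner_integral_integral_eq]

end

section \<open>Second moments from second differences of the moment generating function\<close>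

text \<open>Provides a dominating function that is uniform in the step \<open>s\<close> and
  integrable for Gaussian \<open>y\<close>, as it involves only exponential moments.\<close>

lemma second_difference_exp_bound:
  fixes s y :: real
  assumes "0 < s" "s \<le> 1"
  shows "\<bar>(exp (s * y) + exp (- (s * y)) - 2) / s\<^sup>2\<bar> \<le> 2 * (exp (2 * y) + exp (- (2 * y)))"
proof -
  have *: "exp z - exp (- z) \<le> 2 * z * exp z" for z :: real
  proof -
    have "1 - 2 * z \<le> exp (- 2 * z)" using exp_ge_add_one_self[of "- 2 * z"] by simp
    then have "(1 - 2 * z) * exp z \<le> exp (- 2 * z) * exp z" by (rule mult_right_mono) simp
    then show ?thesis by (simp add: mult_exp_exp algebra_simps)
  qed
  \<comment> \<open>The numerator is the square of \<open>2 * sinh (s * \<bar>y\<bar> / 2)\<close>;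
    the absolute value makes the base nonnegative, so that a bound on the base can be
    squared.\<close>
  have sq: "exp (s * y) + exp (- (s * y)) - 2 = (exp (s * \<bar>y\<bar> / 2) - exp (- (s * \<bar>y\<bar> / 2)))\<^sup>2"
    by (cases "y \<ge> 0") (simp_all add: power2_diff exp_double[symmetric] mult_exp_exp)
  have "(exp (s * \<bar>y\<bar> / 2) - exp (- (s * \<bar>y\<bar> / 2)))\<^sup>2 \<le> (s * \<bar>y\<bar> * exp (s * \<bar>y\<bar> / 2))\<^sup>2"
    using *[of "s * \<bar>y\<bar> / 2"] assms by (intro power_mono) auto
  also have "\<dots> = s\<^sup>2 * (\<bar>y\<bar>\<^sup>2 * exp (s * \<bar>y\<bar>))"
    by (simp add: power_mult_distrib exp_double[symmetric])
  also have "\<dots> \<le> s\<^sup>2 * (2 * exp \<bar>y\<bar> * exp \<bar>y\<bar>)"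
  proof (intro mult_left_mono mult_mono)
    show "\<bar>y\<bar>\<^sup>2 \<le> 2 * exp \<bar>y\<bar>" using exp_lower_Taylor_quadratic[of "\<bar>y\<bar>"] by simp
    show "exp (s * \<bar>y\<bar>) \<le> exp \<bar>y\<bar>" using assms by (simp add: mult_left_le_one_le)
  qed auto
  also have "2 * exp \<bar>y\<bar> * exp \<bar>y\<bar> \<le> 2 * (exp (2 * y) + exp (- (2 * y)))"
    by (cases "y \<ge> 0") (simp_all add: mult_exp_exp mult.assoc add_increasing add_increasing2)
  finally show ?thesis unfolding sq using assms by (simp add: field_simps)
qed

text \<open>The limit is the second derivative of \<open>exp (h * y)\<close> in \<open>h\<close> at
  zero. The case split gives the asymptotic expansion a parameter of known sign.\<close>

lemma second_difference_exp_limit: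
  fixes y :: real
  shows "(\<lambda>n. (exp (y / Suc n) + exp (- (y / Suc n)) - 2) / (1 / Suc n)\<^sup>2) \<longlonglongrightarrow> y\<^sup>2"
  by (cases y "0 :: real" rule: linorder_cases) (real_asymp simp: power2_eq_square)+

context gaussian_vector
begin

text \<open>Differentiates the moment generating function twice at zero along a sequence of steps.
  Dominated convergence yields integrability of the square and its integral together.\<close>

lemma
  shows integrable_inner_square: "integrable P (\<lambda>\<omega>. (u \<bullet> X \<omega>)\<^sup>2)"
    and integral_inner_square: "(\<integral>\<omega>. (u \<bullet> X \<omega>)\<^sup>2 \<partial>P) = u \<bullet> (W *v u)"
proof -
  \<comment> \<open>With \<open>Suc n\<close> the step is never a division by zero and lies in the
    range \<open>0 < s \<le> 1\<close> of the domination bound.\<close>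
  define D where "D n \<omega> = (exp ((1 / Suc n) *  (u \<bullet> X \<omega>)) + exp (- ((1 / Suc n) * (u \<bullet> X \<omega>))) - 2)
    / (1 / Suc n)\<^sup>2" for n \<omega>
  define G where "G \<omega> = 2 * (exp (2 * (u \<bullet> X \<omega>)) + exp (- (2 * (u \<bullet> X \<omega>))))" for \<omega>
  have m[measurable]: "(\<lambda>\<omega>. u \<bullet> X \<omega>) \<in> borel_measurable P" by measurable
  have int: "integrable P (\<lambda>\<omega>. exp (s * (u \<bullet> X \<omega>)))"
    "(\<integral>\<omega>. exp (s * (u \<bullet> X \<omega>)) \<partial>P) = exp (s\<^sup>2 * (u \<bullet> (W *v u)) / 2)" for s :: real
    using integrable_exp[of "s *\<^sub>R u"] integral_exp[of "s *\<^sub>R u"]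
    by (simp_all add: matrix_vector_mult_scaleR power2_eq_square)
  note int' = int[of "- s" for s, simplified]
  have lim: "(\<lambda>n. D n \<omega>) \<longlonglongrightarrow> (u \<bullet> X \<omega>)\<^sup>2" for \<omega>
    unfolding D_def using second_difference_exp_limit[of "u \<bullet> X \<omega>"] by simp
  have bound: "norm (D n \<omega>) \<le> G \<omega>" for n \<omega>
    unfolding D_def G_def real_norm_def by (rule second_difference_exp_bound) auto
  have G: "integrable P G" unfolding G_def using int int' by simp
  have D: "(\<integral>\<omega>. D n \<omega> \<partial>P)
      = (exp ((1 / Suc n)\<^sup>2 * (u \<bullet> (W *v u)) / 2) + exp ((1 / Suc n)\<^sup>2 * (u \<bullet> (W *v u)) / 2) - 2)
        / (1 / Suc n)\<^sup>2" for n
    unfolding D_def using int[of "1 / Suc n"] int'[of "1 / Suc n"]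
    by (simp add: prob_space)
  have meas: "(\<lambda>\<omega>. (u \<bullet> X \<omega>)\<^sup>2) \<in> borel_measurable P" "\<And>n. D n \<in> borel_measurable P"
    unfolding D_def by measurable
  note dc = meas G AE_I2[OF lim] AE_I2[OF bound]
  show "integrable P (\<lambda>\<omega>. (u \<bullet> X \<omega>)\<^sup>2)"
    by (rule integrable_dominated_convergence[OF dc])
  have "(\<lambda>n. \<integral>\<omega>. D n \<omega> \<partial>P) \<longlonglongrightarrow> (\<integral>\<omega>. (u \<bullet> X \<omega>)\<^sup>2 \<partial>P)"
    by (rule integral_dominated_convergence[OF dc])
  \<comment> \<open>The moment generating function is even in the step, so the two exponentials
    coincide; the quotient is \<open>2 * (exp (h^2 * q / 2) - 1) / h^2\<close> with
    \<open>q = u \<bullet> (W *v u)\<close>, which tends to \<open>q\<close>.\<close>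
  moreover have "(\<lambda>n. \<integral>\<omega>. D n \<omega> \<partial>P) \<longlonglongrightarrow> u \<bullet> (W *v u)"
    unfolding D by (cases "u \<bullet> (W *v u)" "0 :: real" rule: linorder_cases)
      (real_asymp simp: power2_eq_square)+
  ultimately show "(\<integral>\<omega>. (u \<bullet> X \<omega>)\<^sup>2 \<partial>P) = u \<bullet> (W *v u)"
    by (rule LIMSEQ_unique)
qed

text \<open>Polarisation recovers the mixed moments from the squares; symmetry of \<open>W\<close>
  merges the two cross terms.\<close>

lemma
  shows integrable_component_product: "integrable P (\<lambda>\<omega>. X \<omega> $ i * X \<omega> $ j)"
    and integral_component_product: "(\<integral>\<omega>. X \<omega> $ i * X \<omega> $ j \<partial>P) = W $ i $ j"
proof -
  let ?a = "axis i 1 :: real^'n" and ?b = "axis j 1 :: real^'n"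
  have eq: "X \<omega> $ i * X \<omega> $ j = (((?a + ?b) \<bullet> X \<omega>)\<^sup>2 - (?a \<bullet> X \<omega>)\<^sup>2 - (?b \<bullet> X \<omega>)\<^sup>2) / 2" for \<omega>
    by (simp add: inner_add_left inner_axis' power2_sum)
  show "integrable P (\<lambda>\<omega>. X \<omega> $ i * X \<omega> $ j)"
    unfolding eq by (intro Bochner_Integration.integrable_diff integrable_divide integrable_inner_square)
  have sym: "?a \<bullet> (W *v ?b) = ?b \<bullet> (W *v ?a)"
    using posdef_selfadjoint[OF posdef_cov, of ?a ?b] by (simp add: inner_commute)
  have "(\<integral>\<omega>. X \<omega> $ i * X \<omega> $ j \<partial>P)
    = ((?a + ?b) \<bullet> (W *v (?a + ?b)) - ?a \<bullet> (W *v ?a) - ?b \<bullet> (W *v ?b)) / 2"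
    unfolding eq by (simp add: integrable_inner_square integral_inner_square)
  also have "\<dots> = ?a \<bullet> (W *v ?b)"
    by (simp add: matrix_vector_right_distrib inner_add_left inner_add_right sym)
  also have "\<dots> = W $ i $ j"
    by (simp add: inner_axis' matrix_vector_mul_component inner_axis)
  finally show "(\<integral>\<omega>. X \<omega> $ i * X \<omega> $ j \<partial>P) = W $ i $ j" .
qed

text \<open>Expanding into coordinates gives the sum of \<open>S $ i $ j * W $ i $ j\<close>, and
  symmetry of \<open>S\<close> turns it into the trace.\<close>

lemma
  fixes S :: "real^'n^'n"
  assumes "transpose S = S"
  shows integrable_quad_form: "integrable P (\<lambda>\<omega>. X \<omega> \<bullet> (S *v X \<omega>))"
    and integral_quad_form: "(\<integral>\<omega>. X \<omega> \<bullet> (S *v X \<omega>) \<partial>P) = trace (W ** S)"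
proof -
  have eq: "x \<bullet> (S *v x) = (\<Sum>i\<in>UNIV. \<Sum>j\<in>UNIV. S $ i $ j * (x $ i * x $ j))" for x
    by (simp add: inner_vec_def matrix_vector_mult_def sum_distrib_left ac_simps)
  have S: "S $ i $ j = S $ j $ i" for i j
    using arg_cong[OF assms, of "\<lambda>M. M $ j $ i"] by (simp add: transpose_def)
  show "integrable P (\<lambda>\<omega>. X \<omega> \<bullet> (S *v X \<omega>))"
    unfolding eq
    by (intro Bochner_Integration.integrable_sum integrable_mult_right integrable_component_product)
  have "(\<integral>\<omega>. X \<omega> \<bullet> (S *v X \<omega>) \<partial>P) = (\<Sum>i\<in>UNIV. \<Sum>j\<in>UNIV. S $ i $ j * W $ i $ j)"
    unfolding eq
    by (simp add: integrable_component_product integral_component_product integrable_sum)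
  also have "\<dots> = trace (W ** S)"
    unfolding trace_def matrix_matrix_mult_def by (subst S) (simp add: mult.commute)
  finally show "(\<integral>\<omega>. X \<omega> \<bullet> (S *v X \<omega>) \<partial>P) = trace (W ** S)" .
qed

lemma integrable_norm_square: "integrable P (\<lambda>\<omega>. (norm (X \<omega>))\<^sup>2)"
  using integrable_quad_form[of "mat 1"] by (simp add: power2_norm_eq_inner)

text \<open>The trace is the expectation of a quadratic form, which coercivity of \<open>S\<close>
  bounds below by a multiple of the variance of \<open>X\<close> in one unit direction
  \<open>u\<close>; that variance is \<open>u \<bullet> (W *v u) > 0\<close>.\<close>

lemma trace_cov_pos:
  assumes "posdef S"
  shows "0 < trace (W ** S)"
proof -
  obtain l where l: "l > 0" "\<And>v. l * (norm v)\<^sup>2 \<le> v \<bullet> (S *v v)"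
    using posdef_coercive[OF assms] by blast
  obtain u :: "real^'n" where u: "norm u = 1" using vector_choose_size[of 1] by auto
  then have "u \<noteq> 0" by auto
  have "0 < l * (u \<bullet> (W *v u))"
    using posdef_cov l(1) \<open>u \<noteq> 0\<close> unfolding posdef_def by (intro mult_pos_pos) auto
  also have "\<dots> = (\<integral>\<omega>. l * (u \<bullet> X \<omega>)\<^sup>2 \<partial>P)" by (simp add: integral_inner_square)
  also have "\<dots> \<le> (\<integral>\<omega>. X \<omega> \<bullet> (S *v X \<omega>) \<partial>P)"
  proof (rule integral_mono)
    show "integrable P (\<lambda>\<omega>. X \<omega> \<bullet> (S *v X \<omega>))"
      using assms by (auto simp: posdef_def intro: integrable_quad_form)
    fix \<omega>
    have "(u \<bullet> X \<omega>)\<^sup>2 \<le> (norm (X \<omega>))\<^sup>2"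
      using Cauchy_Schwarz_ineq2[of u "X \<omega>"] u by (simp add: abs_le_square_iff[symmetric])
    then have "l * (u \<bullet> X \<omega>)\<^sup>2 \<le> l * (norm (X \<omega>))\<^sup>2" using l(1) by simp
    with l(2)[of "X \<omega>"] show "l * (u \<bullet> X \<omega>)\<^sup>2 \<le> X \<omega> \<bullet> (S *v X \<omega>)" by linarith
  qed (simp add: integrable_inner_square)
  also have "\<dots> = trace (W ** S)" using assms by (auto simp: posdef_def intro: integral_quad_form)
  finally show ?thesis .
qed

end

section \<open>The switched closed loop\<close>

text \<open>Causality: only noise before time \<open>k\<close> enters. This is the source of
  independence between the loop at time \<open>k\<close> and \<open>w k\<close>.\<close>

lemma closed_loop_cong:
  assumes "\<And>j. j < k \<Longrightarrow> f j = g j"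
  shows "closed_loop A B K0 K1 Mb t f k = closed_loop A B K0 K1 Mb t g k"
  using assms by (induction k) (auto simp: Let_def split: prod.split)

text \<open>The noise-free part of the next state, written as a function of the pair of state and
  counter so that it can be composed with the whole loop.\<close>

definition drift :: "real^'n^'n \<Rightarrow> real^'m^'n \<Rightarrow> real^'n^'m \<Rightarrow> real^'n^'m \<Rightarrow> real \<Rightarrow> nat
    \<Rightarrow> (real^'n) \<times> nat \<Rightarrow> real^'n" where
  "drift A B K0 K1 Mb t z = A *v fst z + B *v fst (ctrl K0 K1 Mb t (fst z) (snd z))"

lemma closed_loop_Suc_drift:
  "closed_loop A B K0 K1 Mb t f (Suc k) =
    (drift A B K0 K1 Mb t (closed_loop A B K0 K1 Mb t f k) + f k,
     snd (ctrl K0 K1 Mb t (fst (closed_loop A B K0 K1 Mb t f k)) (snd (closed_loop A B K0 K1 Mb t f k))))"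
  by (auto simp: drift_def Let_def split: prod.split)

lemma ctrl_measurable [measurable]:
  "(\<lambda>z. ctrl K0 K1 Mb t (fst z) (snd z)) \<in> borel \<Otimes>\<^sub>M count_space UNIV \<rightarrow>\<^sub>M borel \<Otimes>\<^sub>M count_space UNIV"
  unfolding ctrl_def by measurable

lemma drift_measurable [measurable]:
  "drift A B K0 K1 Mb t \<in> borel \<Otimes>\<^sub>M count_space UNIV \<rightarrow>\<^sub>M borel"
  unfolding drift_def
  using measurable_compose[OF measurable_compose[OF ctrl_measurable measurable_fst] matrix_vector_mult_measurable]
  by measurable

text \<open>Stated over an arbitrary space \<open>N\<close> because it serves both the sample space
  and the product space of the noise coordinates before time \<open>k\<close>.\<close>

lemma closed_loop_measurable:
  assumes "\<And>j. j < k \<Longrightarrow> f j \<in> N \<rightarrow>\<^sub>M borel"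
  shows "(\<lambda>\<omega>. closed_loop A B K0 K1 Mb t (\<lambda>j. f j \<omega>) k) \<in> N \<rightarrow>\<^sub>M borel \<Otimes>\<^sub>M count_space UNIV"
  using assms
proof (induction k)
  case (Suc k)
  have [measurable]: "(\<lambda>\<omega>. closed_loop A B K0 K1 Mb t (\<lambda>j. f j \<omega>) k) \<in> N \<rightarrow>\<^sub>M borel \<Otimes>\<^sub>M count_space UNIV"
    using Suc by simp
  have [measurable]: "f k \<in> N \<rightarrow>\<^sub>M borel" using Suc.prems by simp
  show ?case unfolding closed_loop_Suc_drift
    by (intro measurable_Pair borel_measurable_add measurable_compose[OF _ drift_measurable]
        measurable_compose[OF measurable_compose[OF _ ctrl_measurable] measurable_snd]) measurable
qed simp

text \<open>Reduces the switching rule to two modes: counter and threshold both lead to the same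
  \<open>K0\<close> dynamics, and \<open>K1\<close> acts only on states below the threshold.\<close>

lemma drift_cases:
  obtains "drift A B K0 K1 Mb t z = (A + B ** K0) *v fst z"
      and "fst (ctrl K0 K1 Mb t (fst z) (snd z)) = K0 *v fst z"
  | "drift A B K0 K1 Mb t z = (A + B ** K1) *v fst z"
      and "fst (ctrl K0 K1 Mb t (fst z) (snd z)) = K1 *v fst z" and "norm (fst z) < Mb"
  by (cases "snd z > 0 \<or> norm (fst z) \<ge> Mb")
    (auto simp: drift_def ctrl_def matrix_vector_mult_add_rdistrib matrix_vector_mul_assoc)

lemma square_norm_add_le:
  "(norm (a + b :: 'a :: real_inner))\<^sup>2 \<le> 2 * (norm a)\<^sup>2 + 2 * (norm b)\<^sup>2"
proof -
  have "(norm (a + b))\<^sup>2 + (norm (a - b))\<^sup>2 = 2 * (norm a)\<^sup>2 + 2 * (norm b)\<^sup>2"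
    by (simp add: power2_norm_eq_inner inner_add_left inner_add_right inner_diff_left inner_diff_right)
  then show ?thesis by (metis add_increasing2 order_refl zero_le_power2 add_le_cancel_left le_add_same_cancel1)
qed

lemma norm_drift_le:
  "norm (drift A B K0 K1 Mb t z) \<le> max (mnorm (A + B ** K0)) (mnorm (A + B ** K1)) * norm (fst z)"
proof -
  let ?m = "max (mnorm (A + B ** K0)) (mnorm (A + B ** K1))"
  have "norm (N *v fst z) \<le> ?m * norm (fst z)" if "mnorm N \<le> ?m" for N :: "real^'a^'a"
    using norm_mult_le_mnorm[of N "fst z"] mult_right_mono[OF that norm_ge_zero[of "fst z"]] by linarith
  then show ?thesis by (cases rule: drift_cases[of A B K0 K1 Mb t z]) auto
qed

text \<open>The input uses one of the two gains, and the term of the other gain is nonnegative;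
  hence the sum over both gains covers either mode.\<close>

lemma stage_cost_le:
  fixes Q :: "real^'n^'n" and R :: "real^'m^'m" and K0 K1 :: "real^'n^'m"
    and x :: "real^'n" and xi t :: nat and Mb :: real
  assumes "posdef R"
  defines "u \<equiv> fst (ctrl K0 K1 Mb t x xi)"
  shows "x \<bullet> (Q *v x) + u \<bullet> (R *v u)
    \<le> x \<bullet> ((Q + transpose K0 ** R ** K0 + transpose K1 ** R ** K1) *v x)"
proof -
  have "u = K0 *v x \<or> u = K1 *v x" by (auto simp: u_def ctrl_def)
  moreover have "0 \<le> (K0 *v x) \<bullet> (R *v (K0 *v x))" "0 \<le> (K1 *v x) \<bullet> (R *v (K1 *v x))"
    using posdef_nonneg[OF assms(1)] by auto
  ultimately show ?thesis
    unfolding quad_form_add quad_form_congruence by auto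
qed

text \<open>Below the threshold the possibly destabilising gain $K_1$ is used on a bounded state only, and the
  nonnegative contraction term can be added for free; so one drift inequality covers both modes.\<close>

lemma lyapunov_drift:
  fixes A P0 :: "real^'n^'n" and B :: "real^'m^'n" and K0 K1 :: "real^'n^'m"
  defines "m \<equiv> max (mnorm (A + B ** K0)) (mnorm (A + B ** K1))"
  assumes "posdef P0" "0 \<le> r"
    and contr: "\<And>v. ((A + B ** K0) *v v) \<bullet> (P0 *v ((A + B ** K0) *v v)) \<le> r * (v \<bullet> (P0 *v v))"
  shows "drift A B K0 K1 Mb t z \<bullet> (P0 *v drift A B K0 K1 Mb t z)
    \<le> r * (fst z \<bullet> (P0 *v fst z)) + Mb\<^sup>2 * m\<^sup>2 * mnorm P0"
proof (cases rule: drift_cases[of A B K0 K1 Mb t z])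
  case 1
  have "0 \<le> Mb\<^sup>2 * m\<^sup>2 * mnorm P0" by (simp add: mnorm_nonneg)
  with contr[of "fst z"] show ?thesis unfolding 1 by linarith
next
  case 2
  let ?d = "drift A B K0 K1 Mb t z"
  have m: "0 \<le> m" unfolding m_def by (simp add: mnorm_nonneg max.coboundedI1)
  have "norm ?d \<le> m * norm (fst z)" unfolding m_def by (rule norm_drift_le)
  also have "\<dots> \<le> m * Mb" using 2(3) m by (intro mult_left_mono) auto
  finally have "(norm ?d)\<^sup>2 \<le> (m * Mb)\<^sup>2" by (rule power_mono) simp
  then have "mnorm P0 * (norm ?d)\<^sup>2 \<le> mnorm P0 * (m * Mb)\<^sup>2"
    by (rule mult_left_mono) (rule mnorm_nonneg)
  with quad_form_le_mnorm[of ?d P0] have "?d \<bullet> (P0 *v ?d) \<le> Mb\<^sup>2 * m\<^sup>2 * mnorm P0"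
    by (simp add: power_mult_distrib mult_ac)
  moreover have "0 \<le> r * (fst z \<bullet> (P0 *v fst z))"
    using assms by (simp add: posdef_nonneg)
  ultimately show ?thesis by linarith
qed

section \<open>Second moments and expected Lyapunov function of the noisy loop\<close>

locale noisy_loop = prob_space P for P :: "'a measure" +
  fixes w :: "nat \<Rightarrow> 'a \<Rightarrow> real^'n"
    and A :: "real^'n^'n" and B :: "real^'m^'n" and W :: "real^'n^'n"
    and K0 K1 :: "real^'n^'m" and Mb :: real and t :: nat
  assumes noise: "distributed P lborel (w k) (\<lambda>x. ennreal (gauss_density W x))"
    and indep: "indep_vars (\<lambda>_. borel) w UNIV"
    and posdef_W: "posdef W"
begin

text \<open>Each noise vector is its own instance, so the Gaussian facts acquire the time index as
  an argument.\<close>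

sublocale gaussian_vector P W "w k" for k
  by unfold_locales (rule noise posdef_W)+

abbreviation loop :: "nat \<Rightarrow> 'a \<Rightarrow> (real^'n) \<times> nat" where
  "loop k \<omega> \<equiv> closed_loop A B K0 K1 Mb t (\<lambda>j. w j \<omega>) k"

abbreviation x :: "nat \<Rightarrow> 'a \<Rightarrow> real^'n" where "x k \<omega> \<equiv> fst (loop k \<omega>)"

abbreviation d :: "nat \<Rightarrow> 'a \<Rightarrow> real^'n" where "d k \<omega> \<equiv> drift A B K0 K1 Mb t (loop k \<omega>)"

lemma x_Suc: "x (Suc k) \<omega> = d k \<omega> + w k \<omega>"
  unfolding closed_loop_Suc_drift by simp

lemma loop_measurable [measurable]: "loop k \<in> P \<rightarrow>\<^sub>M borel \<Otimes>\<^sub>M count_space UNIV"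
  by (rule closed_loop_measurable) (rule rv)

lemma d_measurable [measurable]: "d k \<in> borel_measurable P"
  by (rule measurable_compose[OF loop_measurable drift_measurable])

lemma x_measurable [measurable]: "x k \<in> borel_measurable P"
  by measurable

text \<open>The loop at time \<open>k\<close> is a function of the noise indexed by
  \<open>{..<k}\<close>, and disjoint blocks of an independent family are independent.\<close>

lemma indep_loop_noise:
  fixes g :: "(real^'n) \<times> nat \<Rightarrow> real" and h :: "real^'n \<Rightarrow> real"
  assumes "g \<in> borel_measurable (borel \<Otimes>\<^sub>M count_space UNIV)" and "h \<in> borel_measurable borel"
  shows "indep_var borel (\<lambda>\<omega>. g (loop k \<omega>)) borel (\<lambda>\<omega>. h (w k \<omega>))"
proof -
  let ?G = "\<lambda>f. g (closed_loop A B K0 K1 Mb t f k)" and ?H = "\<lambda>f. h (f k)"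
  have "indep_var (PiM {..<k} (\<lambda>_. borel)) (\<lambda>\<omega>. restrict (\<lambda>i. w i \<omega>) {..<k})
      (PiM {k} (\<lambda>_. borel)) (\<lambda>\<omega>. restrict (\<lambda>i. w i \<omega>) {k})"
    by (rule indep_var_restrict[OF indep]) auto
  moreover have "?G \<in> borel_measurable (PiM {..<k} (\<lambda>_. borel))"
    by (rule measurable_compose[OF closed_loop_measurable[where f="\<lambda>j f. f j"] assms(1)]) measurable
  moreover have "?H \<in> borel_measurable (PiM {k} (\<lambda>_. borel))"
    by (rule measurable_compose[OF _ assms(2)]) measurable
  ultimately have "indep_var borel (?G \<circ> (\<lambda>\<omega>. restrict (\<lambda>i. w i \<omega>) {..<k}))
      borel (?H \<circ> (\<lambda>\<omega>. restrict (\<lambda>i. w i \<omega>) {k}))"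
    by (rule indep_var_compose)
  moreover have restr: "closed_loop A B K0 K1 Mb t (\<lambda>i\<in>{..<k}. w i \<omega>) k = loop k \<omega>" for \<omega>
    by (rule closed_loop_cong) simp
  have "?G \<circ> (\<lambda>\<omega>. restrict (\<lambda>i. w i \<omega>) {..<k}) = (\<lambda>\<omega>. g (loop k \<omega>))"
    by (simp add: fun_eq_iff restr)
  ultimately show ?thesis by (simp add: comp_def)
qed

lemma integrable_norm_drift_square:
  assumes "integrable P (\<lambda>\<omega>. (norm (x k \<omega>))\<^sup>2)"
  shows "integrable P (\<lambda>\<omega>. (norm (d k \<omega>))\<^sup>2)"
proof (rule Bochner_Integration.integrable_bound)
  let ?m = "max (mnorm (A + B ** K0)) (mnorm (A + B ** K1))"
  show "integrable P (\<lambda>\<omega>. ?m\<^sup>2 * (norm (x k \<omega>))\<^sup>2)" using assms by simp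
  show "AE \<omega> in P. norm ((norm (d k \<omega>))\<^sup>2) \<le> norm (?m\<^sup>2 * (norm (x k \<omega>))\<^sup>2)"
    using power_mono[OF norm_drift_le norm_ge_zero, where n=2]
    by (intro AE_I2) (simp add: power_mult_distrib)
qed measurable

text \<open>Finite second moments propagate, as the drift grows at most linearly and the noise is
  square integrable. All later expectations are thus genuine integrals rather than default
  values.\<close>

lemma integrable_norm_state_square: "integrable P (\<lambda>\<omega>. (norm (x k \<omega>))\<^sup>2)"
proof (induction k)
  case (Suc k)
  show ?case
  proof (rule Bochner_Integration.integrable_bound)
    show "integrable P (\<lambda>\<omega>. 2 * (norm (d k \<omega>))\<^sup>2 + 2 * (norm (w k \<omega>))\<^sup>2)"
      using integrable_norm_drift_square[OF Suc] integrable_norm_square[of k] by simp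
    show "AE \<omega> in P. norm ((norm (x (Suc k) \<omega>))\<^sup>2)
        \<le> norm (2 * (norm (d k \<omega>))\<^sup>2 + 2 * (norm (w k \<omega>))\<^sup>2)"
      unfolding x_Suc using square_norm_add_le by (intro AE_I2) simp
  qed measurable
qed simp

lemma integrable_quad_form_square:
  assumes "integrable P (\<lambda>\<omega>. (norm (f \<omega>))\<^sup>2)" and [measurable]: "f \<in> borel_measurable P"
  shows "integrable P (\<lambda>\<omega>. f \<omega> \<bullet> ((S :: real^'n^'n) *v f \<omega>))"
proof (rule Bochner_Integration.integrable_bound)
  show "integrable P (\<lambda>\<omega>. mnorm S * (norm (f \<omega>))\<^sup>2)" using assms by simp
  have "\<bar>v \<bullet> (S *v v)\<bar> \<le> mnorm S * (norm v)\<^sup>2" for v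
    using Cauchy_Schwarz_ineq2[of v "S *v v"]
      mult_left_mono[OF norm_mult_le_mnorm[of S v] norm_ge_zero[of v]]
    by (simp add: power2_eq_square mult_ac)
  then show "AE \<omega> in P. norm (f \<omega> \<bullet> (S *v f \<omega>)) \<le> norm (mnorm S * (norm (f \<omega>))\<^sup>2)"
    using mnorm_nonneg[of S] by (intro AE_I2) simp
qed measurable

text \<open>Each coordinate product splits into a product of expectations by independence, and the
  noise factor has mean zero.\<close>

lemma
  fixes S :: "real^'n^'n"
  shows integrable_cross_term: "integrable P (\<lambda>\<omega>. (S *v d k \<omega>) \<bullet> w k \<omega>)"
    and integral_cross_term: "(\<integral>\<omega>. (S *v d k \<omega>) \<bullet> w k \<omega> \<partial>P) = 0"
proof -
  have ind: "indep_var borel (\<lambda>\<omega>. (S *v d k \<omega>) $ i) borel (\<lambda>\<omega>. w k \<omega> $ i)" for i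
    by (rule indep_loop_noise[of "\<lambda>z. (S *v drift A B K0 K1 Mb t z) $ i" "\<lambda>x. x $ i"])
      (auto intro!: measurable_compose[OF drift_measurable] borel_measurable_continuous_onI continuous_intros)
  have sq: "integrable P f" if "integrable P (\<lambda>\<omega>. (f \<omega>)\<^sup>2)" "f \<in> borel_measurable P" for f :: "'a \<Rightarrow> real"
    by (rule square_integrable_imp_integrable[OF that(2,1)])
  have iw: "integrable P (\<lambda>\<omega>. w k \<omega> $ i)" for i
    by (rule sq) (use integrable_component_product[of k i i] in \<open>simp_all add: power2_eq_square vec_nth_measurable\<close>)
  have ew: "(\<integral>\<omega>. w k \<omega> $ i \<partial>P) = 0" for i
    using mean_zero[of "axis i 1" k] by (simp add: inner_axis')
  have id: "integrable P (\<lambda>\<omega>. (S *v d k \<omega>) $ i)" for i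
  proof (rule sq, rule Bochner_Integration.integrable_bound)
    show "integrable P (\<lambda>\<omega>. (mnorm S)\<^sup>2 * (norm (d k \<omega>))\<^sup>2)"
      using integrable_norm_drift_square[OF integrable_norm_state_square] by simp
    show "AE \<omega> in P. norm (((S *v d k \<omega>) $ i)\<^sup>2) \<le> norm ((mnorm S)\<^sup>2 * (norm (d k \<omega>))\<^sup>2)"
    proof (rule AE_I2)
      fix \<omega>
      have "\<bar>(S *v d k \<omega>) $ i\<bar> \<le> mnorm S * norm (d k \<omega>)"
        using component_le_norm_cart norm_mult_le_mnorm by (rule order_trans)
      then have "\<bar>(S *v d k \<omega>) $ i\<bar>\<^sup>2 \<le> (mnorm S * norm (d k \<omega>))\<^sup>2"
        by (rule power_mono) simp
      then show "norm (((S *v d k \<omega>) $ i)\<^sup>2) \<le> norm ((mnorm S)\<^sup>2 * (norm (d k \<omega>))\<^sup>2)"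
        by (simp add: power_mult_distrib)
    qed
  qed measurable
  have eq: "(S *v d k \<omega>) \<bullet> w k \<omega> = (\<Sum>i\<in>UNIV. (S *v d k \<omega>) $ i * w k \<omega> $ i)" for \<omega>
    by (simp add: inner_vec_def)
  have int: "integrable P (\<lambda>\<omega>. (S *v d k \<omega>) $ i * w k \<omega> $ i)" for i
    by (rule indep_var_integrable[OF ind id iw])
  then show "integrable P (\<lambda>\<omega>. (S *v d k \<omega>) \<bullet> w k \<omega>)"
    unfolding eq by (intro Bochner_Integration.integrable_sum)
  show "(\<integral>\<omega>. (S *v d k \<omega>) \<bullet> w k \<omega> \<partial>P) = 0"
    unfolding eq using int
    by (simp add: indep_var_lebesgue_integral[OF ind id iw] ew)
qed

text \<open>In the expanded quadratic form the cross term vanishes in expectation and the pure noise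
  term contributes the trace.\<close>

lemma expected_quad_form_step:
  assumes "posdef S"
  shows "(\<integral>\<omega>. x (Suc k) \<omega> \<bullet> (S *v x (Suc k) \<omega>) \<partial>P)
    = (\<integral>\<omega>. d k \<omega> \<bullet> (S *v d k \<omega>) \<partial>P) + trace (W ** S)"
proof -
  have sym: "transpose S = S" using assms by (simp add: posdef_def)
  have eq: "x (Suc k) \<omega> \<bullet> (S *v x (Suc k) \<omega>)
    = d k \<omega> \<bullet> (S *v d k \<omega>) + 2 * ((S *v d k \<omega>) \<bullet> w k \<omega>) + w k \<omega> \<bullet> (S *v w k \<omega>)" for \<omega>
    unfolding x_Suc using posdef_selfadjoint[OF assms, of "d k \<omega>" "w k \<omega>"]
    by (simp add: matrix_vector_right_distrib inner_add_left inner_add_right inner_commute)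
  have "integrable P (\<lambda>\<omega>. d k \<omega> \<bullet> (S *v d k \<omega>))"
    by (rule integrable_quad_form_square[OF integrable_norm_drift_square[OF integrable_norm_state_square] d_measurable])
  then show ?thesis unfolding eq
    by (simp add: integrable_cross_term integral_cross_term integrable_quad_form[OF sym] integral_quad_form[OF sym])
qed

text \<open>The expectations satisfy \<open>a (Suc k) \<le> r * a k + c\<close> with
  \<open>a 0 = 0\<close>. The bound \<open>c / (1 - r)\<close> is the fixed point of this affine
  map, so starting below it means staying below it.\<close>

lemma expected_lyapunov_le:
  fixes S :: "real^'n^'n"
  assumes S: "posdef S" and r: "0 \<le> r" "r < 1"
    and contr: "\<And>v. ((A + B ** K0) *v v) \<bullet> (S *v ((A + B ** K0) *v v)) \<le> r * (v \<bullet> (S *v v))"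
  shows "(\<integral>\<omega>. x k \<omega> \<bullet> (S *v x k \<omega>) \<partial>P)
    \<le> (Mb\<^sup>2 * (max (mnorm (A + B ** K0)) (mnorm (A + B ** K1)))\<^sup>2 * mnorm S + trace (W ** S)) / (1 - r)"
    (is "_ \<le> (?b + _) / _")
proof (induction k)
  case 0
  have "0 \<le> ?b" by (simp add: mnorm_nonneg)
  with trace_cov_pos[OF S] r show ?case by simp
next
  case (Suc k)
  let ?c = "?b + trace (W ** S)"
  note int_x = integrable_quad_form_square[OF integrable_norm_state_square x_measurable, of k S]
  have "(\<integral>\<omega>. d k \<omega> \<bullet> (S *v d k \<omega>) \<partial>P) \<le> (\<integral>\<omega>. r * (x k \<omega> \<bullet> (S *v x k \<omega>)) + ?b \<partial>P)"
  proof (rule integral_mono)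
    show "integrable P (\<lambda>\<omega>. d k \<omega> \<bullet> (S *v d k \<omega>))"
      by (rule integrable_quad_form_square[OF integrable_norm_drift_square[OF integrable_norm_state_square] d_measurable])
    show "integrable P (\<lambda>\<omega>. r * (x k \<omega> \<bullet> (S *v x k \<omega>)) + ?b)" using int_x by simp
  qed (rule lyapunov_drift[OF S r(1) contr])
  also have "\<dots> = r * (\<integral>\<omega>. x k \<omega> \<bullet> (S *v x k \<omega>) \<partial>P) + ?b"
    using int_x by (simp add: prob_space)
  also have "\<dots> \<le> r * (?c / (1 - r)) + ?b"
    by (intro add_right_mono mult_left_mono Suc r)
  finally have "(\<integral>\<omega>. x (Suc k) \<omega> \<bullet> (S *v x (Suc k) \<omega>) \<partial>P) \<le> r * (?c / (1 - r)) + ?c"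
    unfolding expected_quad_form_step[OF S] by simp
  also have "\<dots> = ?c / (1 - r)" using r by (simp add: field_simps)
  finally show ?case .
qed

section \<open>From the Lyapunov bound to the average cost\<close>

text \<open>Each stage cost is at most \<open>q\<close> times the Lyapunov function, so every
  finite-horizon average obeys the bound, and the limsup inherits it.\<close>

lemma avg_cost_le:
  fixes Q S :: "real^'n^'n" and R :: "real^'m^'m"
  assumes Q: "posdef Q" and R: "posdef R" and S: "posdef S"
    and V: "\<And>k. (\<integral>\<omega>. x k \<omega> \<bullet> (S *v x k \<omega>) \<partial>P) \<le> v" and "0 \<le> v"
  defines "q \<equiv> wnorm S (Q + transpose K0 ** R ** K0 + transpose K1 ** R ** K1)"
  assumes q: "0 \<le> q"
  shows "avg_cost P w A B K0 K1 Mb t Q R \<le> ereal (v * q)"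
proof -
  define c where "c k \<omega> = x k \<omega> \<bullet> (Q *v x k \<omega>) + fst (ctrl K0 K1 Mb t (x k \<omega>) (snd (loop k \<omega>)))
    \<bullet> (R *v fst (ctrl K0 K1 Mb t (x k \<omega>) (snd (loop k \<omega>))))" for k \<omega>
  have c: "(\<Sum>k<T. (let x = state A B K0 K1 Mb t (\<lambda>j. w j \<omega>) k;
                    u = input A B K0 K1 Mb t (\<lambda>j. w j \<omega>) k
                in x \<bullet> (Q *v x) + u \<bullet> (R *v u))) = (\<Sum>k<T. c k \<omega>)" for T \<omega>
    by (intro sum.cong refl) (simp add: c_def state_def input_def Let_def split: prod.split)
  have cle: "c k \<omega> \<le> q * (x k \<omega> \<bullet> (S *v x k \<omega>))" for k \<omega>
    unfolding c_def q_def using stage_cost_le[OF R] quad_form_le_wnorm[OF S] by (rule order_trans)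
  have int_S: "integrable P (\<lambda>\<omega>. x k \<omega> \<bullet> (S *v x k \<omega>))" for k
    by (rule integrable_quad_form_square[OF integrable_norm_state_square x_measurable])
  have avg: "1 / real T * (\<integral>\<omega>. (\<Sum>k<T. c k \<omega>) \<partial>P) \<le> v * q" for T
  proof (cases "T = 0")
    case False
    have "(\<integral>\<omega>. (\<Sum>k<T. c k \<omega>) \<partial>P) \<le> (\<integral>\<omega>. (\<Sum>k<T. q * (x k \<omega> \<bullet> (S *v x k \<omega>))) \<partial>P)"
    \<comment> \<open>This form of monotonicity asks for integrability of the dominating,
      nonnegative side.\<close>
    proof (rule integral_mono')
      show "integrable P (\<lambda>\<omega>. \<Sum>k<T. q * (x k \<omega> \<bullet> (S *v x k \<omega>)))"
        by (intro Bochner_Integration.integrable_sum integrable_mult_right int_S)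
    qed (auto intro!: sum_mono cle sum_nonneg mult_nonneg_nonneg q posdef_nonneg[OF S])
    also have "\<dots> = (\<Sum>k<T. q * (\<integral>\<omega>. x k \<omega> \<bullet> (S *v x k \<omega>) \<partial>P))"
      using int_S by simp
    also have "\<dots> \<le> (\<Sum>k<T. q * v)" by (intro sum_mono mult_left_mono V q)
    finally show ?thesis using False by (simp add: field_simps)
  \<comment> \<open>For \<open>T = 0\<close> the factor \<open>1 / real T\<close> is zero by
    convention, leaving \<open>0 \<le> v * q\<close>.\<close>
  qed (use assms q in simp)
  show ?thesis unfolding avg_cost_def c
    by (rule Limsup_bounded) (simp add: avg del: times_divide_eq_left)
qed

end

theorem theorem1:
  fixes P :: "'a measure"
    and w :: "nat \<Rightarrow> 'a \<Rightarrow> real^'n"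
    and A :: "real^'n^'n" and B :: "real^'m^'n"
    and W Q P0 :: "real^'n^'n" and R :: "real^'m^'m"
    and K0 K1 :: "real^'n^'m"
    and Mb rho0 :: real and t :: nat
  assumes "prob_space P"
    and "\<And>k. distributed P lborel (w k) (\<lambda>x. ennreal (gauss_density W x))"
    and "prob_space.indep_vars P (\<lambda>_. borel) w UNIV"
    and "posdef W"
    and "controllable A B"
    and "posdef Q" and "posdef R"
    and "spectral_radius (A + B ** K0) < 1"
    and "Mb > 0" and "t \<ge> 1"
    and "posdef P0" and "0 < rho0" and "rho0 < 1"
    and "posdef (rho0 *\<^sub>R P0 - transpose (A + B ** K0) ** P0 ** (A + B ** K0))"
  shows "avg_cost P w A B K0 K1 Mb t Q R <
    ereal ((Mb\<^sup>2 * (max (mnorm (A + B ** K0)) (mnorm (A + B ** K1)))\<^sup>2 * mnorm P0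
             + trace (W ** P0))
           * wnorm P0 (Q + transpose K0 ** R ** K0 + transpose K1 ** R ** K1) / (1 - rho0))"
proof -
  interpret noisy_loop P w A B W K0 K1 Mb t
    using assms(1-4) by (intro noisy_loop.intro noisy_loop_axioms.intro)
  let ?Q01 = "Q + transpose K0 ** R ** K0 + transpose K1 ** R ** K1"
  define b where "b = Mb\<^sup>2 * (max (mnorm (A + B ** K0)) (mnorm (A + B ** K1)))\<^sup>2 * mnorm P0
      + trace (W ** P0)"
  \<comment> \<open>The contraction hypothesis improves to the factor \<open>rho0 - e\<close>, which
    lies between zero and one.\<close>
  obtain e where e: "0 < e" "e \<le> rho0" "\<And>v. v \<bullet> ((transpose (A + B ** K0) ** P0 ** (A + B ** K0)) *v v)
      \<le> (rho0 - e) * (v \<bullet> (P0 *v v))"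
    using posdef_diff_margin[OF assms(11,14,12)] by blast
  have b: "0 < b"
    unfolding b_def using trace_cov_pos[OF assms(11)] by (intro add_nonneg_pos) (simp_all add: mnorm_nonneg)
  have transpose_add: "transpose (M + N) = transpose M + transpose N" for M N :: "real^'n^'n"
    by (simp add: transpose_def vec_eq_iff)
  have q: "0 < wnorm P0 ?Q01"
  proof (rule wnorm_pos[OF assms(11)])
    have "v \<bullet> (?Q01 *v v) > 0" if "v \<noteq> 0" for v
      unfolding quad_form_add quad_form_congruence
      using assms(6) that posdef_nonneg[OF assms(7)]
      by (intro add_pos_nonneg) (auto simp: posdef_def)
    moreover have "transpose ?Q01 = ?Q01"
      using assms(6,7)
      by (simp add: posdef_def transpose_add matrix_transpose_mul matrix_mul_assoc)
    ultimately show "posdef ?Q01" by (simp add: posdef_def)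
  qed
  have "(\<integral>\<omega>. x k \<omega> \<bullet> (P0 *v x k \<omega>) \<partial>P) \<le> b / (1 - (rho0 - e))" for k
    unfolding b_def using assms(11-13) e
    by (intro expected_lyapunov_le) (auto simp: quad_form_congruence)
  then have "avg_cost P w A B K0 K1 Mb t Q R \<le> ereal (b / (1 - (rho0 - e)) * wnorm P0 ?Q01)"
    using assms(6,7,11,13) b e q by (intro avg_cost_le) auto
  \<comment> \<open>Strictness enters here: passing from \<open>rho0 - e\<close> to
    \<open>rho0\<close> shrinks the denominator, and both \<open>b\<close> and the weighted norm are
    positive.\<close>
  also have "\<dots> < ereal (b / (1 - rho0) * wnorm P0 ?Q01)"
    using b q e(1) assms(13) by (simp add: mult_strict_right_mono divide_strict_left_mono)
  finally show ?thesis unfolding b_def by simp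
qed

end
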